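(* Let $(I,\cdot,1)$ be a unitary magma and $(X,\tau)$ a topological space. The following conditions are equivalent: (a) The space $(X,\tau)$ is $I$-cartesian. (b) The topology $\tau$ is determined by a cartesian spacial fibrous preorder $(X,(\leq^{i})_{i\in I},(\partial^{i})_{i\in I})$ indexed by $(I,\cdot,1)$ as $$\mathcal{O}\in \tau \Leftrightarrow \forall x\in \mathcal{O},\ \exists i\in I,\ N(i,x)\subseteq \mathcal{O},$$ with $N(i,x)=\{y\in X\mid x\leq^{i} y\}$. (c) There exists a map $N\colon I\times X\to\mathcal{P}(X)$ such that (i) $x\in N(n,x)$, for all $n\in I$, $x\in X$; (ii) $N(n,x)\subseteq\{y\in X\mid \exists k\in I,\ N(k,y)\subseteq N(n,x)\}$, for all $n\in I$, $x\in X$; (iii) $N(n\cdot m,x)\subseteq N(n,x)\cap N(m,x)$, for all $n,m\in I$, $x\in X$; for which $\tau$ is determined as $$\mathcal{O}\in \tau \Leftrightarrow \forall x\in \mathcal{O},\ \exists n\in I,\ N(n,x)\subseteq \mathcal{O}.$$ (d) There exists a ternary relation $R\subseteq I\times X\times X$ together with a map $p\colon R\to I$ such that, for all $n,m\in I$ and $x,y,z\in X$, (i) $(n,x,x)\in R$; (ii) if $(n,x,y)\in R$ and $(p(n,x,y),y,z)\in R$ then $(n,x,z)\in R$; (iii) if $(n\cdot m,x,y)\in R$ then $(n,x,y)\in R$ and $(m,x,y)\in R$; for which $\tau$ is determined as $$\mathcal{O}\in \tau \Leftrightarrow \forall x\in \mathcal{O},\ \exists n\in I,\ N_R(n,x)\subseteq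 \mathcal{O},$$ with $N_R(n,x)=\{y\in X\mid (n,x,y)\in R\}$. (e) There are maps $\eta\colon I\times X\to \tau$ and $\gamma\colon\{(U,x)\mid x\in U\in \tau\}\to I$ such that: (i) $x\in \eta(n,x)$ for every $n\in I$ and $x\in X$; (ii) $\eta(\gamma(U,x),x)\subseteq U$, for all $x\in U\in \tau$; (iii) $\eta(n\cdot m,x)\subseteq \eta(n,x)\cap \eta(m,x)$, for all $n,m\in I$ and $x\in X$.
   Context: A unitary magma $(I,\cdot,1)$ is a set $I$ with a distinguished element $1\in I$ and a binary operation $(i,j)\mapsto i\cdot j=ij$ on $I$ such that $i\cdot 1=i=1\cdot i$ for all $i\in I$ (associativity is not required). A cartesian spacial fibrous preorder indexed by the unitary magma $(I,\cdot,1)$ is a system $(X,(\leq^{i})_{i\in I},(\partial^{i})_{i\in I})$ where $X$ is a set and, for every $i\in I$, $\leq^{i}$ is a binary relation on $X$ and $\partial^{i}$ is a partial map $X\times X\to I$ defined for all pairs $(x,y)$ such that $x\leq^{i} y$, such that for all $x,y,z\in X$ and $i,j\in I$: (C1) $x\leq^{i} x$; (C2) if $x\leq^{i} y$, $\partial^{i}(x,y)=j$ and $y\leq^{j} z$, then $x\leq^{i} z$; (C3) if $x\leq^{ij} y$, then $x\leq^{i} y$ and $x\leq^{j} y$. Every such system gives rise to a topology on $X$ in which $\mathcal{O}\subseteq X$ is open if and only if for every $x\in\mathcal{O}$ there is $i\in I$ with $\{y\in X\mid x\leq^{i}y\}\subseteq\mathcal{O}$. A topological space is called $I$-cartesian if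 it is obtained in this way from some cartesian spacial fibrous preorder indexed by $I$ (so (a) and (b) are equivalent by definition). $\mathcal{P}(X)$ denotes the power-set of $X$. *)

theory Defs
  imports "HOL-Analysis.Abstract_Topology" "HOL-Library.FuncSet"
begin

locale unitary_magma =
  fixes I :: "'i set" and mult :: "'i \<Rightarrow> 'i \<Rightarrow> 'i" and unit :: 'i
  assumes unit_closed: "unit \<in> I"
    and mult_closed: "\<lbrakk>i \<in> I; j \<in> I\<rbrakk> \<Longrightarrow> mult i j \<in> I"
    and mult_unit: "i \<in> I \<Longrightarrow> mult i unit = i"
    and unit_mult: "i \<in> I \<Longrightarrow> mult unit i = i"

text \<open>
  The relation \<open>\<le>\<^sup>i\<close> is the set \<open>le i\<close> of pairs, and the partial map \<open>\<partial>\<^sup>i\<close> is \<open>d i\<close>, whose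
  domain is exactly \<open>le i\<close>. Only the values of \<open>le\<close> and \<open>d\<close> at indices in \<open>I\<close> matter.
\<close>

locale cartesian_spacial_fibrous_preorder = unitary_magma I mult unit
  for I :: "'i set" and mult :: "'i \<Rightarrow> 'i \<Rightarrow> 'i" and unit :: 'i +
  fixes X :: "'a set" and le :: "'i \<Rightarrow> ('a \<times> 'a) set" and d :: "'i \<Rightarrow> 'a \<times> 'a \<rightharpoonup> 'i"
  assumes le_on: "i \<in> I \<Longrightarrow> le i \<subseteq> X \<times> X"
    and dom_d: "i \<in> I \<Longrightarrow> dom (d i) = le i"
    and ran_d: "i \<in> I \<Longrightarrow> ran (d i) \<subseteq> I"
    and C1: "\<lbrakk>i \<in> I; x \<in> X\<rbrakk> \<Longrightarrow> (x, x) \<in> le i"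
    and C2: "\<lbrakk>i \<in> I; j \<in> I; x \<in> X; y \<in> X; z \<in> X; (x, y) \<in> le i; d i (x, y) = Some j; (y, z) \<in> le j\<rbrakk>
      \<Longrightarrow> (x, z) \<in> le i"
    and C3: "\<lbrakk>i \<in> I; j \<in> I; x \<in> X; y \<in> X; (x, y) \<in> le (mult i j)\<rbrakk>
      \<Longrightarrow> (x, y) \<in> le i \<and> (x, y) \<in> le j"

definition fibrous_topology :: "'i set \<Rightarrow> 'a set \<Rightarrow> ('i \<Rightarrow> ('a \<times> 'a) set) \<Rightarrow> 'a topology" where
  "fibrous_topology I X le =
    topology (\<lambda>U. U \<subseteq> X \<and> (\<forall>x\<in>U. \<exists>i\<in>I. {y \<in> X. (x, y) \<in> le i} \<subseteq> U))"

text \<open>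
  The predicate above is a topology whenever \<open>le\<close> comes from a cartesian spacial fibrous preorder,
  so the use of \<^const>\<open>topology\<close> is then meaningful.
\<close>

context cartesian_spacial_fibrous_preorder
begin

lemma openin_fibrous_topology:
  "openin (fibrous_topology I X le) U \<longleftrightarrow>
    U \<subseteq> X \<and> (\<forall>x\<in>U. \<exists>i\<in>I. {y \<in> X. (x, y) \<in> le i} \<subseteq> U)"
proof -
  let ?P = "\<lambda>U. U \<subseteq> X \<and> (\<forall>x\<in>U. \<exists>i\<in>I. {y \<in> X. (x, y) \<in> le i} \<subseteq> U)"
  have inter: "?P (S \<inter> T)" if S: "?P S" and T: "?P T" for S T
  proof (intro conjI ballI)
    show "S \<inter> T \<subseteq> X" using S by blast
    fix x assume x: "x \<in> S \<inter> T"
    obtain i where i: "i \<in> I" "{y \<in> X. (x, y) \<in> le i} \<subseteq> S" using S x by blast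
    obtain j where j: "j \<in> I" "{y \<in> X. (x, y) \<in> le j} \<subseteq> T" using T x by blast
    have "x \<in> X" using S x by blast
    then have "{y \<in> X. (x, y) \<in> le (mult i j)} \<subseteq> S \<inter> T"
      using i j C3[of i j x] by blast
    then show "\<exists>k\<in>I. {y \<in> X. (x, y) \<in> le k} \<subseteq> S \<inter> T"
      using mult_closed i(1) j(1) by blast
  qed
  have union: "?P (\<Union>K)" if K: "\<forall>S\<in>K. ?P S" for K
  proof (intro conjI ballI)
    show "\<Union>K \<subseteq> X" using K by blast
    fix x assume "x \<in> \<Union>K"
    then obtain S where S: "S \<in> K" "x \<in> S" by blast
    then obtain i where "i \<in> I" "{y \<in> X. (x, y) \<in> le i} \<subseteq> S" using K by blast
    then show "\<exists>k\<in>I. {y \<in> X. (x, y) \<in> le k} \<subseteq> \<Union>K" using S by blast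
  qed
  have "istopology ?P"
    unfolding istopology_def using inter union by blast
  then show ?thesis
    unfolding fibrous_topology_def by (simp add: topology_inverse')
qed

lemma topspace_fibrous_topology: "topspace (fibrous_topology I X le) = X"
proof
  show "topspace (fibrous_topology I X le) \<subseteq> X"
    using openin_topspace openin_fibrous_topology by blast
  have "openin (fibrous_topology I X le) X"
    unfolding openin_fibrous_topology using unit_closed by blast
  then show "X \<subseteq> topspace (fibrous_topology I X le)"
    by (rule openin_subset)
qed

end

definition cartesian_space ::
    "'i set \<Rightarrow> ('i \<Rightarrow> 'i \<Rightarrow> 'i) \<Rightarrow> 'i \<Rightarrow> 'a topology \<Rightarrow> bool" where
  "cartesian_space I mult unit T \<longleftrightarrow>
    (\<exists>le d. cartesian_spacial_fibrous_preorder I mult unit (topspace T) le d \<and>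
      T = fibrous_topology I (topspace T) le)"

end

theory Submission
  imports Defs
begin

text \<open>
  A neighbourhood map \<open>N\<close> as in (c) amounts to the relation \<open>y \<in> N(n, x)\<close>, and a choice of the index \<open>k\<close>
  in (c)(ii) is a choice of \<open>p(n, x, y)\<close>, respectively of \<open>\<partial>\<^sup>n(x, y)\<close>. Moreover (c)(ii) says exactly that
  every \<open>N(n, x)\<close> is open, so that \<open>N\<close> itself serves as \<open>\<eta>\<close>, with \<open>\<gamma>\<close> choosing an index that witnesses
  openness. Conversely, \<open>k = \<gamma>(\<eta>(n, x), y)\<close> recovers (c)(ii) from (e).
\<close>

section \<open>Conditions (b) to (e) as predicates\<close>

text \<open>Open sets lie in the space anyway, so the equivalence is stated for subsets of
  \<open>topspace T\<close> only. The curried form of \<open>N\<close> lets sections of a relation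
  be plugged in as well as the uncurried maps of (c) and (e).\<close>

definition determines :: "'i set \<Rightarrow> 'a topology \<Rightarrow> ('i \<Rightarrow> 'a \<Rightarrow> 'a set) \<Rightarrow> bool" where
  "determines I T N \<longleftrightarrow>
    (\<forall>U\<subseteq>topspace T. openin T U \<longleftrightarrow> (\<forall>x\<in>U. \<exists>n\<in>I. N n x \<subseteq> U))"

text \<open>This predicate and the next three repeat (b) to (e) clause by clause with
  \<open>topspace T\<close> for the underlying set, so that unfolding them at the end yields the
  theorem literally.\<close>

definition preorder_system ::
    "'i set \<Rightarrow> ('i \<Rightarrow> 'i \<Rightarrow> 'i) \<Rightarrow> 'i \<Rightarrow> 'a topology \<Rightarrow>
      ('i \<Rightarrow> ('a \<times> 'a) set) \<Rightarrow> ('i \<Rightarrow> 'a \<times> 'a \<rightharpoonup> 'i) \<Rightarrow> bool" where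
  "preorder_system I mult unit T le d \<longleftrightarrow>
    cartesian_spacial_fibrous_preorder I mult unit (topspace T) le d \<and>
    determines I T (\<lambda>i x. {y \<in> topspace T. (x, y) \<in> le i})"

definition neighbourhood_system ::
    "'i set \<Rightarrow> ('i \<Rightarrow> 'i \<Rightarrow> 'i) \<Rightarrow> 'a topology \<Rightarrow> ('i \<times> 'a \<Rightarrow> 'a set) \<Rightarrow> bool" where
  "neighbourhood_system I mult T N \<longleftrightarrow>
    N \<in> I \<times> topspace T \<rightarrow> Pow (topspace T) \<and>
    (\<forall>n\<in>I. \<forall>x\<in>topspace T. x \<in> N (n, x)) \<and>
    (\<forall>n\<in>I. \<forall>x\<in>topspace T.
      N (n, x) \<subseteq> {y \<in> topspace T. \<exists>k\<in>I. N (k, y) \<subseteq> N (n, x)}) \<and>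
    (\<forall>n\<in>I. \<forall>m\<in>I. \<forall>x\<in>topspace T. N (mult n m, x) \<subseteq> N (n, x) \<inter> N (m, x)) \<and>
    determines I T (\<lambda>n x. N (n, x))"

definition relation_system ::
    "'i set \<Rightarrow> ('i \<Rightarrow> 'i \<Rightarrow> 'i) \<Rightarrow> 'a topology \<Rightarrow>
      ('i \<times> 'a \<times> 'a) set \<Rightarrow> ('i \<times> 'a \<times> 'a \<Rightarrow> 'i) \<Rightarrow> bool" where
  "relation_system I mult T R p \<longleftrightarrow>
    R \<subseteq> I \<times> topspace T \<times> topspace T \<and> p \<in> R \<rightarrow> I \<and>
    (\<forall>n\<in>I. \<forall>x\<in>topspace T. (n, x, x) \<in> R) \<and>
    (\<forall>n\<in>I. \<forall>x\<in>topspace T. \<forall>y\<in>topspace T. \<forall>z\<in>topspace T.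
      (n, x, y) \<in> R \<and> (p (n, x, y), y, z) \<in> R \<longrightarrow> (n, x, z) \<in> R) \<and>
    (\<forall>n\<in>I. \<forall>m\<in>I. \<forall>x\<in>topspace T. \<forall>y\<in>topspace T.
      (mult n m, x, y) \<in> R \<longrightarrow> (n, x, y) \<in> R \<and> (m, x, y) \<in> R) \<and>
    determines I T (\<lambda>n x. {y \<in> topspace T. (n, x, y) \<in> R})"

text \<open>There is no \<open>determines\<close> clause here: that \<open>\<eta>\<close> determines
  the topology is a consequence of the openness of its values, of (i) and of (ii).\<close>

definition open_system ::
    "'i set \<Rightarrow> ('i \<Rightarrow> 'i \<Rightarrow> 'i) \<Rightarrow> 'a topology \<Rightarrow>
      ('i \<times> 'a \<Rightarrow> 'a set) \<Rightarrow> ('a set \<times> 'a \<Rightarrow> 'i) \<Rightarrow> bool" where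
  "open_system I mult T \<eta> \<gamma> \<longleftrightarrow>
    \<eta> \<in> I \<times> topspace T \<rightarrow> {U. openin T U} \<and>
    \<gamma> \<in> {(U, x). x \<in> U \<and> openin T U} \<rightarrow> I \<and>
    (\<forall>n\<in>I. \<forall>x\<in>topspace T. x \<in> \<eta> (n, x)) \<and>
    (\<forall>U x. x \<in> U \<and> openin T U \<longrightarrow> \<eta> (\<gamma> (U, x), x) \<subseteq> U) \<and>
    (\<forall>n\<in>I. \<forall>m\<in>I. \<forall>x\<in>topspace T. \<eta> (mult n m, x) \<subseteq> \<eta> (n, x) \<inter> \<eta> (m, x))"

text \<open>Serves to replace a neighbourhood map by the sections of its relation, which agree with
  it only at indices in \<open>I\<close> and points of the space.\<close>

lemma determines_cong:
  assumes "determines I T N" "\<And>n x. n \<in> I \<Longrightarrow> x \<in> topspace T \<Longrightarrow> N' n x = N n x"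
  shows "determines I T N'"
proof -
  have "(\<forall>x\<in>U. \<exists>n\<in>I. N' n x \<subseteq> U) \<longleftrightarrow> (\<forall>x\<in>U. \<exists>n\<in>I. N n x \<subseteq> U)"
    if "U \<subseteq> topspace T" for U
    by (intro ball_cong bex_cong refl) (simp add: assms(2) subsetD[OF that])
  then show ?thesis
    using assms(1) unfolding determines_def by simp
qed

text \<open>A topology is given by its open sets, and those of the fibrous topology are
  characterised by \<open>openin_fibrous_topology\<close>.\<close>

lemma cartesian_space_iff_preorder_system:
  "cartesian_space I mult unit T \<longleftrightarrow> (\<exists>le d. preorder_system I mult unit T le d)"
proof -
  have "T = fibrous_topology I (topspace T) le \<longleftrightarrow>
      determines I T (\<lambda>i x. {y \<in> topspace T. (x, y) \<in> le i})"
    if "cartesian_spacial_fibrous_preorder I mult unit (topspace T) le d" for le d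
  proof -
    \<comment> \<open>A set not contained in the space satisfies neither side of the equivalence on
      the left, so testing subsets of the space is enough.\<close>
    have "(\<forall>U. openin T U \<longleftrightarrow> U \<subseteq> topspace T \<and> P U) \<longleftrightarrow>
        (\<forall>U\<subseteq>topspace T. openin T U \<longleftrightarrow> P U)" for P
      using openin_subset[of T] by blast
    then show ?thesis
      unfolding topology_eq determines_def
        cartesian_spacial_fibrous_preorder.openin_fibrous_topology[OF that] .
  qed
  then show ?thesis
    unfolding cartesian_space_def preorder_system_def
    by (intro ex_cong1 conj_cong refl)
qed

section \<open>Preorders, neighbourhood maps and ternary relations\<close>

text \<open>The index \<open>k\<close> asked for at \<open>y\<close> in (c)(ii) is the value of
  \<open>d n\<close> at \<open>(x, y)\<close>; C2 then gives the inclusion of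
  neighbourhoods.\<close>

lemma neighbourhood_system_of_preorder_system:
  assumes "preorder_system I mult unit T le d"
  shows "neighbourhood_system I mult T (\<lambda>(i, x). {y \<in> topspace T. (x, y) \<in> le i})"
proof -
  interpret cartesian_spacial_fibrous_preorder I mult unit "topspace T" le d
    using assms unfolding preorder_system_def by (rule conjunct1)
  have "\<exists>k\<in>I. {z \<in> topspace T. (y, z) \<in> le k} \<subseteq> {z \<in> topspace T. (x, z) \<in> le n}"
    if n: "n \<in> I" and x: "x \<in> topspace T" and y: "y \<in> topspace T" and xy: "(x, y) \<in> le n"
    for n x y
  proof -
    \<comment> \<open>The partial map is defined at \<open>(x, y)\<close> because its domain is all
      of \<open>le n\<close>.\<close>
    obtain k where k: "d n (x, y) = Some k"
      using dom_d[OF n] xy by blast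
    then have "k \<in> I"
      using ran_d[OF n] by (auto simp: ran_def)
    then show ?thesis
      using C2[OF n _ x y _ xy k] by blast
  qed
  moreover have "determines I T (\<lambda>i x. {y \<in> topspace T. (x, y) \<in> le i})"
    using assms unfolding preorder_system_def by (rule conjunct2)
  moreover have "{y \<in> topspace T. (x, y) \<in> le (mult n m)} \<subseteq>
      {y \<in> topspace T. (x, y) \<in> le n} \<inter> {y \<in> topspace T. (x, y) \<in> le m}"
    if "n \<in> I" "m \<in> I" "x \<in> topspace T" for n m x
    using C3[OF that] by blast
  ultimately show ?thesis
    unfolding neighbourhood_system_def using C1 by (simp add: subset_iff Pi_iff split_beta)
qed

text \<open>With \<open>p (n, x, y)\<close> a chosen \<open>k\<close> from (c)(ii), the
  neighbourhood of \<open>y\<close> at that index is contained in \<open>N (n, x)\<close>, and this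
  inclusion is (d)(ii).\<close>

lemma relation_system_of_neighbourhood_system:
  assumes "neighbourhood_system I mult T N"
  shows "\<exists>R p. relation_system I mult T R p"
proof -
  let ?X = "topspace T"
  have N: "N \<in> I \<times> ?X \<rightarrow> Pow ?X" and N1: "\<forall>n\<in>I. \<forall>x\<in>?X. x \<in> N (n, x)"
    and N2: "\<forall>n\<in>I. \<forall>x\<in>?X. N (n, x) \<subseteq> {y \<in> ?X. \<exists>k\<in>I. N (k, y) \<subseteq> N (n, x)}"
    and N3: "\<forall>n\<in>I. \<forall>m\<in>I. \<forall>x\<in>?X. N (mult n m, x) \<subseteq> N (n, x) \<inter> N (m, x)"
    and det: "determines I T (\<lambda>n x. N (n, x))"
    using assms unfolding neighbourhood_system_def by argo+
  have sub: "N (n, x) \<subseteq> ?X" if "n \<in> I" "x \<in> ?X" for n x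
    using N that by blast
  have "\<forall>n\<in>I. \<forall>x\<in>?X. \<forall>y\<in>N (n, x). \<exists>k. k \<in> I \<and> N (k, y) \<subseteq> N (n, x)"
    using N2 by blast
  then obtain q where q: "\<And>n x y. \<lbrakk>n \<in> I; x \<in> ?X; y \<in> N (n, x)\<rbrakk> \<Longrightarrow>
      q n x y \<in> I \<and> N (q n x y, y) \<subseteq> N (n, x)"
    by metis
  \<comment> \<open>Restricting to \<open>n \<in> I\<close> and \<open>x \<in> ?X\<close> matters,
    since nothing is known about \<open>N\<close> elsewhere and \<open>R\<close> must lie in the
    triple product.\<close>
  define R where "R = {(n, x, y). n \<in> I \<and> x \<in> ?X \<and> y \<in> N (n, x)}"
  define p where "p = (\<lambda>(n, x, y). q n x y)"
  have "determines I T (\<lambda>n x. {y \<in> ?X. (n, x, y) \<in> R})"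
    using det by (rule determines_cong) (use sub in \<open>auto simp: R_def\<close>)
  moreover have "R \<subseteq> I \<times> ?X \<times> ?X" "p \<in> R \<rightarrow> I"
    using sub q by (auto simp: R_def p_def)
  moreover have "\<forall>n\<in>I. \<forall>x\<in>?X. (n, x, x) \<in> R"
    using N1 by (simp add: R_def)
  moreover have "\<forall>n\<in>I. \<forall>x\<in>?X. \<forall>y\<in>?X. \<forall>z\<in>?X.
      (n, x, y) \<in> R \<and> (p (n, x, y), y, z) \<in> R \<longrightarrow> (n, x, z) \<in> R"
  proof (intro ballI impI)
    fix n x y z assume "(n, x, y) \<in> R \<and> (p (n, x, y), y, z) \<in> R"
    then show "(n, x, z) \<in> R"
      using q[of n x y] by (auto simp: R_def p_def)
  qed
  moreover have "\<forall>n\<in>I. \<forall>m\<in>I. \<forall>x\<in>?X. \<forall>y\<in>?X.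
      (mult n m, x, y) \<in> R \<longrightarrow> (n, x, y) \<in> R \<and> (m, x, y) \<in> R"
  proof (intro ballI impI)
    fix n m x y assume "n \<in> I" "m \<in> I" "x \<in> ?X" "(mult n m, x, y) \<in> R"
    then show "(n, x, y) \<in> R \<and> (m, x, y) \<in> R"
      using N3[rule_format, of n m x] by (auto simp: R_def)
  qed
  ultimately have "relation_system I mult T R p"
    unfolding relation_system_def by (intro conjI)
  then show ?thesis
    by (intro exI)
qed

text \<open>Only a change of notation: \<open>R\<close> and \<open>p\<close> are split according to
  their first argument. The magma hypothesis supplies the part of the preorder locale that concerns
  \<open>I\<close>.\<close>

lemma preorder_system_of_relation_system:
  assumes "unitary_magma I mult unit" "relation_system I mult T R p"
  shows "\<exists>le d. preorder_system I mult unit T le d"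
proof -
  let ?X = "topspace T"
  define le where "le = (\<lambda>i. {(x, y). (i, x, y) \<in> R})"
  \<comment> \<open>The value \<open>None\<close> off \<open>R\<close> makes the domain of
    \<open>d i\<close> exactly \<open>le i\<close>.\<close>
  define d where "d = (\<lambda>i (x, y). if (i, x, y) \<in> R then Some (p (i, x, y)) else None)"
  have R: "R \<subseteq> I \<times> ?X \<times> ?X" and p: "p \<in> R \<rightarrow> I"
    and R1: "\<forall>n\<in>I. \<forall>x\<in>?X. (n, x, x) \<in> R"
    and R2: "\<forall>n\<in>I. \<forall>x\<in>?X. \<forall>y\<in>?X. \<forall>z\<in>?X.
      (n, x, y) \<in> R \<and> (p (n, x, y), y, z) \<in> R \<longrightarrow> (n, x, z) \<in> R"
    and R3: "\<forall>n\<in>I. \<forall>m\<in>I. \<forall>x\<in>?X. \<forall>y\<in>?X.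
      (mult n m, x, y) \<in> R \<longrightarrow> (n, x, y) \<in> R \<and> (m, x, y) \<in> R"
    and det: "determines I T (\<lambda>n x. {y \<in> ?X. (n, x, y) \<in> R})"
    using assms(2) unfolding relation_system_def by argo+
  have "cartesian_spacial_fibrous_preorder I mult unit ?X le d"
  proof (rule cartesian_spacial_fibrous_preorder.intro[OF assms(1)], unfold_locales)
    fix i assume "i \<in> I"
    show "le i \<subseteq> ?X \<times> ?X" using R by (auto simp: le_def)
    show "dom (d i) = le i" by (auto simp: le_def d_def split: if_splits)
    show "ran (d i) \<subseteq> I" using p by (auto simp: d_def ran_def split: if_splits)
  next
    fix i j x y z
    assume "i \<in> I" "x \<in> ?X" "y \<in> ?X" "z \<in> ?X"
      and "(x, y) \<in> le i" "d i (x, y) = Some j" "(y, z) \<in> le j"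
    \<comment> \<open>The assumption on \<open>d i\<close> forces \<open>j = p (i, x, y)\<close>, so
      C2 becomes (d)(ii).\<close>
    then show "(x, z) \<in> le i"
      using R2[rule_format, of i x y z] by (auto simp: le_def d_def split: if_splits)
  next
    fix i x assume "i \<in> I" "x \<in> ?X"
    then show "(x, x) \<in> le i" using R1 by (simp add: le_def)
  next
    fix i j x y assume "i \<in> I" "j \<in> I" "x \<in> ?X" "y \<in> ?X" "(x, y) \<in> le (mult i j)"
    then show "(x, y) \<in> le i \<and> (x, y) \<in> le j"
      using R3[rule_format, of i j x y] by (simp add: le_def)
  qed
  moreover have "determines I T (\<lambda>i x. {y \<in> ?X. (x, y) \<in> le i})"
    using det by (simp add: le_def)
  ultimately show ?thesis
    unfolding preorder_system_def by (intro exI conjI)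
qed

section \<open>Neighbourhood maps with open values\<close>

lemma open_system_of_neighbourhood_system:
  assumes "neighbourhood_system I mult T N"
  shows "\<exists>\<gamma>. open_system I mult T N \<gamma>"
proof -
  let ?X = "topspace T"
  have N1: "\<forall>n\<in>I. \<forall>x\<in>?X. x \<in> N (n, x)"
    and N2: "\<forall>n\<in>I. \<forall>x\<in>?X. N (n, x) \<subseteq> {y \<in> ?X. \<exists>k\<in>I. N (k, y) \<subseteq> N (n, x)}"
    and N3: "\<forall>n\<in>I. \<forall>m\<in>I. \<forall>x\<in>?X. N (mult n m, x) \<subseteq> N (n, x) \<inter> N (m, x)"
    and N4: "determines I T (\<lambda>n x. N (n, x))"
    using assms unfolding neighbourhood_system_def by argo+
  have det: "openin T U \<longleftrightarrow> (\<forall>x\<in>U. \<exists>n\<in>I. N (n, x) \<subseteq> U)" if "U \<subseteq> ?X" for U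
    using N4[unfolded determines_def, rule_format, OF that] .
  have op: "openin T (N (n, x))" if "n \<in> I" "x \<in> ?X" for n x
  proof -
    \<comment> \<open>Condition (c)(ii) is the openness criterion \<open>det\<close> applied to the
      set \<open>N (n, x)\<close> itself.\<close>
    have "N (n, x) \<subseteq> {y \<in> ?X. \<exists>k\<in>I. N (k, y) \<subseteq> N (n, x)}"
      using N2 that by simp
    then show ?thesis
      using det[of "N (n, x)"] by blast
  qed
  \<comment> \<open>The choice is meaningful when \<open>U\<close> is open and
    \<open>x \<in> U\<close>, since \<open>det\<close> then provides such an index; elsewhere the
    value is arbitrary.\<close>
  define \<gamma> where "\<gamma> = (\<lambda>(U, x). SOME n. n \<in> I \<and> N (n, x) \<subseteq> U)"
  have \<gamma>: "\<gamma> (U, x) \<in> I \<and> N (\<gamma> (U, x), x) \<subseteq> U" if "x \<in> U" "openin T U" for U x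
  proof -
    have "\<exists>n. n \<in> I \<and> N (n, x) \<subseteq> U"
      using det[OF openin_subset] that by blast
    from someI_ex[OF this] show ?thesis
      by (simp add: \<gamma>_def)
  qed
  have "N \<in> I \<times> ?X \<rightarrow> {U. openin T U}"
    using op by auto
  moreover have "\<gamma> \<in> {(U, x). x \<in> U \<and> openin T U} \<rightarrow> I"
    using \<gamma> by auto
  moreover have "\<forall>U x. x \<in> U \<and> openin T U \<longrightarrow> N (\<gamma> (U, x), x) \<subseteq> U"
    using \<gamma> by simp
  ultimately have "open_system I mult T N \<gamma>"
    unfolding open_system_def using N1 N3 by (intro conjI)
  then show ?thesis by blast
qed

text \<open>At each point the open sets \<open>\<eta> (n, x)\<close> form a neighbourhood base, with
  \<open>\<gamma>\<close> naming a member inside a given open set.\<close>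

lemma neighbourhood_system_of_open_system:
  assumes "open_system I mult T \<eta> \<gamma>"
  shows "neighbourhood_system I mult T \<eta>"
proof -
  let ?X = "topspace T"
  have \<eta>: "\<eta> \<in> I \<times> ?X \<rightarrow> {U. openin T U}"
    and \<gamma>: "\<gamma> \<in> {(U, x). x \<in> U \<and> openin T U} \<rightarrow> I"
    and mem: "\<forall>n\<in>I. \<forall>x\<in>?X. x \<in> \<eta> (n, x)"
    and \<gamma>_sub: "\<forall>U x. x \<in> U \<and> openin T U \<longrightarrow> \<eta> (\<gamma> (U, x), x) \<subseteq> U"
    and mult: "\<forall>n\<in>I. \<forall>m\<in>I. \<forall>x\<in>?X. \<eta> (mult n m, x) \<subseteq> \<eta> (n, x) \<inter> \<eta> (m, x)"
    using assms unfolding open_system_def by argo+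
  have op: "openin T (\<eta> (n, x))" if "n \<in> I" "x \<in> ?X" for n x
    using \<eta> that by blast
  \<comment> \<open>Used twice: for an arbitrary open \<open>U\<close> it is one half of
    \<open>determines\<close>, and for \<open>U\<close> a value of \<open>\<eta>\<close> it is
    (c)(ii).\<close>
  have basic: "\<exists>k\<in>I. \<eta> (k, x) \<subseteq> U" if "x \<in> U" "openin T U" for U x
  proof -
    have "\<gamma> (U, x) \<in> I"
      using \<gamma> that by blast
    moreover have "\<eta> (\<gamma> (U, x), x) \<subseteq> U"
      using \<gamma>_sub that by simp
    ultimately show ?thesis
      by (rule bexI[rotated])
  qed
  have "determines I T (\<lambda>n x. \<eta> (n, x))"
    unfolding determines_def
  proof (intro allI impI iffI ballI)
    fix U x assume "openin T U" "x \<in> U"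
    then show "\<exists>n\<in>I. \<eta> (n, x) \<subseteq> U" by (rule basic[rotated])
  next
    fix U assume U: "U \<subseteq> ?X" "\<forall>x\<in>U. \<exists>n\<in>I. \<eta> (n, x) \<subseteq> U"
    show "openin T U"
    \<comment> \<open>It suffices to find an open set around each point inside \<open>U\<close>; a
      suitable \<open>\<eta> (n, x)\<close> contains \<open>x\<close> by (e)(i).\<close>
    proof (rule openin_subopen[THEN iffD2], rule ballI)
      fix x assume x: "x \<in> U"
      obtain n where n: "n \<in> I" "\<eta> (n, x) \<subseteq> U"
        using U(2) x by (elim ballE bexE) auto
      have "x \<in> ?X"
        using U(1) x by (rule subsetD)
      then show "\<exists>V. openin T V \<and> x \<in> V \<and> V \<subseteq> U"
        using n op[OF n(1)] mem by (intro exI[of _ "\<eta> (n, x)"]) simp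
    qed
  qed
  moreover have "\<forall>n\<in>I. \<forall>x\<in>?X. \<eta> (n, x) \<subseteq> {y \<in> ?X. \<exists>k\<in>I. \<eta> (k, y) \<subseteq> \<eta> (n, x)}"
  proof (intro ballI subsetI CollectI conjI)
    fix n x y assume n: "n \<in> I" "x \<in> ?X" and y: "y \<in> \<eta> (n, x)"
    show "y \<in> ?X"
      using openin_subset[OF op[OF n]] y by (rule subsetD)
    \<comment> \<open>Here the index is \<open>\<gamma> (\<eta> (n, x), y)\<close>.\<close>
    show "\<exists>k\<in>I. \<eta> (k, y) \<subseteq> \<eta> (n, x)"
      using y op[OF n] by (rule basic)
  qed
  moreover have "\<eta> \<in> I \<times> ?X \<rightarrow> Pow ?X"
    using openin_subset[OF op] by auto
  ultimately show ?thesis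
    unfolding neighbourhood_system_def using mem mult by (intro conjI)
qed

section \<open>Equivalence of the five conditions\<close>

theorem theorem3p1:
  fixes I :: "'i set" and mult :: "'i \<Rightarrow> 'i \<Rightarrow> 'i" (infixl "\<cdot>" 70) and unit :: 'i
    and T :: "'a topology" and X :: "'a set"
  assumes "unitary_magma I mult unit"
    and "X = topspace T"
  shows
    "let
      a = cartesian_space I mult unit T;
      b = (\<exists>le d. cartesian_spacial_fibrous_preorder I mult unit X le d \<and>
            (\<forall>U\<subseteq>X. openin T U \<longleftrightarrow> (\<forall>x\<in>U. \<exists>i\<in>I. {y \<in> X. (x, y) \<in> le i} \<subseteq> U)));
      c = (\<exists>N. N \<in> I \<times> X \<rightarrow> Pow X \<and>
            (\<forall>n\<in>I. \<forall>x\<in>X. x \<in> N (n, x)) \<and>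
            (\<forall>n\<in>I. \<forall>x\<in>X. N (n, x) \<subseteq> {y \<in> X. \<exists>k\<in>I. N (k, y) \<subseteq> N (n, x)}) \<and>
            (\<forall>n\<in>I. \<forall>m\<in>I. \<forall>x\<in>X. N (n \<cdot> m, x) \<subseteq> N (n, x) \<inter> N (m, x)) \<and>
            (\<forall>U\<subseteq>X. openin T U \<longleftrightarrow> (\<forall>x\<in>U. \<exists>n\<in>I. N (n, x) \<subseteq> U)));
      d = (\<exists>R p. R \<subseteq> I \<times> X \<times> X \<and> p \<in> R \<rightarrow> I \<and>
            (\<forall>n\<in>I. \<forall>x\<in>X. (n, x, x) \<in> R) \<and>
            (\<forall>n\<in>I. \<forall>x\<in>X. \<forall>y\<in>X. \<forall>z\<in>X.
              (n, x, y) \<in> R \<and> (p (n, x, y), y, z) \<in> R \<longrightarrow> (n, x, z) \<in> R) \<and>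
            (\<forall>n\<in>I. \<forall>m\<in>I. \<forall>x\<in>X. \<forall>y\<in>X.
              (n \<cdot> m, x, y) \<in> R \<longrightarrow> (n, x, y) \<in> R \<and> (m, x, y) \<in> R) \<and>
            (\<forall>U\<subseteq>X. openin T U \<longleftrightarrow> (\<forall>x\<in>U. \<exists>n\<in>I. {y \<in> X. (n, x, y) \<in> R} \<subseteq> U)));
      e = (\<exists>\<eta> \<gamma>. \<eta> \<in> I \<times> X \<rightarrow> {U. openin T U} \<and>
            \<gamma> \<in> {(U, x). x \<in> U \<and> openin T U} \<rightarrow> I \<and>
            (\<forall>n\<in>I. \<forall>x\<in>X. x \<in> \<eta> (n, x)) \<and>
            (\<forall>U x. x \<in> U \<and> openin T U \<longrightarrow> \<eta> (\<gamma> (U, x), x) \<subseteq> U) \<and>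
            (\<forall>n\<in>I. \<forall>m\<in>I. \<forall>x\<in>X. \<eta> (n \<cdot> m, x) \<subseteq> \<eta> (n, x) \<inter> \<eta> (m, x)))
    in (a \<longleftrightarrow> b) \<and> (b \<longleftrightarrow> c) \<and> (c \<longleftrightarrow> d) \<and> (d \<longleftrightarrow> e)"
proof -
  let ?b = "\<exists>le d. preorder_system I mult unit T le d"
  let ?c = "\<exists>N. neighbourhood_system I mult T N"
  let ?d = "\<exists>R p. relation_system I mult T R p"
  let ?e = "\<exists>\<eta> \<gamma>. open_system I mult T \<eta> \<gamma>"
  \<comment> \<open>Conditions (b), (c) and (d) are joined in a cycle, and (e) is tied to (c) in
    both directions.\<close>
  have "?b \<longrightarrow> ?c"
    by (intro impI, elim exE) (rule exI, rule neighbourhood_system_of_preorder_system)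
  moreover have "?c \<longrightarrow> ?d"
    by (intro impI, elim exE) (rule relation_system_of_neighbourhood_system)
  moreover have "?d \<longrightarrow> ?b"
    by (intro impI, elim exE) (rule preorder_system_of_relation_system[OF assms(1)])
  moreover have "?c \<longrightarrow> ?e"
    by (intro impI, elim exE) (rule exI, rule open_system_of_neighbourhood_system)
  moreover have "?e \<longrightarrow> ?c"
    by (intro impI, elim exE) (rule exI, rule neighbourhood_system_of_open_system)
  ultimately have "(cartesian_space I mult unit T \<longleftrightarrow> ?b) \<and> (?b \<longleftrightarrow> ?c) \<and> (?c \<longleftrightarrow> ?d) \<and> (?d \<longleftrightarrow> ?e)"
    unfolding cartesian_space_iff_preorder_system by argo
  then show ?thesis
    unfolding Let_def assms(2) preorder_system_def neighbourhood_system_def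
      relation_system_def open_system_def determines_def .
qed

end
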